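(* Let $n=1$. Eigenvalues are counted with multiplicity. (a) $H_{\lambda\mu}$ has exactly $k$ eigenvalues in $(-\infty,0)$ if $(\lambda,\mu)\in D_k$, $k\in\{0,1,2,3\}$, where $D_0=G_0$, $D_1=G_1\cap\mathfrak S_-$, $D_2=G_1\cap\mathfrak S_+$, $D_3=G_2$. In addition, for such $(\lambda,\mu)$, $0$ is neither a threshold resonance nor a threshold eigenvalue of $H_{\lambda\mu}$. (b) If $(\lambda,\mu)\in S_1=\mathfrak S_0$, then $H_{\lambda\mu}$ has a super-threshold resonance (at $0$). (c) $H_{\lambda\mu}$ has $0$ eigenvalues in $(-\infty,0)$ if $(\lambda,\mu)\in B_0=\Gamma_l$, $2$ eigenvalues in $(-\infty,0)$ if $(\lambda,\mu)\in B_2=\Gamma_r$, and $1$ eigenvalue in $(-\infty,0)$ if $(\lambda,\mu)\in S_1$; in all these cases $0$ is neither a threshold resonance nor a threshold eigenvalue. In particular $H_{\lambda\mu}$ has neither a threshold resonance nor a threshold eigenvalue.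
   Context: Let $\mathbb T=(-\pi,\pi]$ be the circle with Lebesgue measure, and $E(p)=1-\cos p$. For $\lambda,\mu\in\mathbb R$, $H_{\lambda\mu}$ is the bounded self-adjoint operator on $L^2(\mathbb T)$ $$(H_{\lambda\mu}f)(p)=E(p)f(p)-\frac1{2\pi}\int_{\mathbb T}\big(\mu+\lambda\cos(p-s)\big)f(s)\,ds .$$ It decomposes as $H_{\lambda\mu}=H^{\mathrm e}_{\lambda\mu}\oplus H^{\mathrm o}_\lambda$ on even and odd functions, with $$(H^{\mathrm e}_{\lambda\mu}f)(p)=E(p)f(p)-\frac{\mu}{2\pi}\int_{\mathbb T} f(q)\,dq-\frac{\lambda}{2\pi}\cos p\int_{\mathbb T}\cos q\, f(q)\,dq,\qquad (H^{\mathrm o}_{\lambda}f)(p)=E(p)f(p)-\frac{\lambda}{2\pi}\sin p\int_{\mathbb T}\sin q\, f(q)\,dq .$$ The equations $H^{\mathrm e}_{\lambda\mu}f=0$ and $H^{\mathrm o}_\lambda f=0$ are considered, by these formulas (a.e.), also for measurable even (resp. odd) $f$ not in $L^2$; every integral with nonzero coefficient is required to converge absolutely. $0$ is a (lower) threshold eigenvalue of $H^{\mathrm e}_{\lambda\mu}$ (resp. $H^{\mathrm o}_\lambda$) if the corresponding equation has a nonzero even (resp. odd) solution in $L^2(\mathbb T)$; a (lower) threshold resonance if it has such a solution in $L^1(\mathbb T)\setminus L^2(\mathbb T)$; a (lower) super-threshold resonance if it has such a solution $f\notin L^1(\mathbb T)$ with $f\in L^\epsilon(\mathbb T)$ for every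 $0<\epsilon<1$. $0$ is a threshold eigenvalue (resonance, super-threshold resonance) of $H_{\lambda\mu}$ if it is one of $H^{\mathrm e}_{\lambda\mu}$ or of $H^{\mathrm o}_\lambda$. Let $\overline{\mathcal H}_0(\lambda,\mu)=(\lambda-1)(\mu-1)-1$. $\Gamma_l$ (resp. $\Gamma_r$) is the branch of $\{\overline{\mathcal H}_0=0\}$ with $\lambda<1$ (resp. $\lambda>1$); $G_0=\{\overline{\mathcal H}_0>0,\lambda<1\}$, $G_1=\{\overline{\mathcal H}_0<0\}$, $G_2=\{\overline{\mathcal H}_0>0,\lambda>1\}$ in $\mathbb R^2$. With $\lambda_s=1$, the sets $\mathfrak S_-,\mathfrak S_0,\mathfrak S_+$ consist of the $(\lambda,\mu)\in\mathbb R^2$ with $\lambda<\lambda_s$, $\lambda=\lambda_s$, $\lambda>\lambda_s$. *)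

theory Defs
  imports "HOL-Analysis.Analysis" "HOL-Library.Extended_Nat"
begin

text \<open>
  Elements of function spaces on the circle are represented by functions
  \<open>real \<Rightarrow> complex\<close>, of which only the values on \<open>(-\<pi>, \<pi>]\<close> up to Lebesgue null sets matter.
  Accordingly equations, parity and being nonzero are all understood almost everywhere.
\<close>

abbreviation circle :: "real measure" where
  "circle \<equiv> lebesgue_on {-pi<..pi}"

definition Lspace :: "real \<Rightarrow> (real \<Rightarrow> complex) set" where
  "Lspace r = {f \<in> borel_measurable circle. integrable circle (\<lambda>p. cmod (f p) powr r)}"

definition ae_nonzero :: "(real \<Rightarrow> complex) \<Rightarrow> bool" where
  "ae_nonzero f \<longleftrightarrow> \<not> (AE p in circle. f p = 0)"

definition even_fun :: "(real \<Rightarrow> complex) \<Rightarrow> bool" where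
  "even_fun f \<longleftrightarrow> (AE p in circle. f (- p) = f p)"

definition odd_fun :: "(real \<Rightarrow> complex) \<Rightarrow> bool" where
  "odd_fun f \<longleftrightarrow> (AE p in circle. f (- p) = - f p)"

definition dispersion :: "real \<Rightarrow> real" where
  "dispersion p = 1 - cos p"

definition H :: "real \<Rightarrow> real \<Rightarrow> (real \<Rightarrow> complex) \<Rightarrow> real \<Rightarrow> complex" where
  "H lam mu f p =
     of_real (dispersion p) * f p
     - of_real (1 / (2 * pi)) * (LINT s|circle. of_real (mu + lam * cos (p - s)) * f s)"

definition H_even :: "real \<Rightarrow> real \<Rightarrow> (real \<Rightarrow> complex) \<Rightarrow> real \<Rightarrow> complex" where
  "H_even lam mu f p =
     of_real (dispersion p) * f p
     - of_real (mu / (2 * pi)) * (LINT q|circle. f q)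
     - of_real (lam / (2 * pi) * cos p) * (LINT q|circle. of_real (cos q) * f q)"

definition H_odd :: "real \<Rightarrow> (real \<Rightarrow> complex) \<Rightarrow> real \<Rightarrow> complex" where
  "H_odd lam f p =
     of_real (dispersion p) * f p
     - of_real (lam / (2 * pi) * sin p) * (LINT q|circle. of_real (sin q) * f q)"

definition eigenspace :: "real \<Rightarrow> real \<Rightarrow> real \<Rightarrow> (real \<Rightarrow> complex) set" where
  "eigenspace lam mu z = {f \<in> Lspace 2. AE p in circle. H lam mu f p = of_real z * f p}"

definition eigenvalue :: "real \<Rightarrow> real \<Rightarrow> real \<Rightarrow> bool" where
  "eigenvalue lam mu z \<longleftrightarrow> (\<exists>f \<in> eigenspace lam mu z. ae_nonzero f)"

text \<open>Linear independence over the complex numbers of the classes of \<open>f 0, \<dots>, f (n - 1)\<close>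
  modulo equality almost everywhere.\<close>

definition ae_independent :: "nat \<Rightarrow> (nat \<Rightarrow> real \<Rightarrow> complex) \<Rightarrow> bool" where
  "ae_independent n f \<longleftrightarrow>
     (\<forall>c :: nat \<Rightarrow> complex. (AE p in circle. (\<Sum>i<n. c i * f i p) = 0) \<longrightarrow> (\<forall>i<n. c i = 0))"

text \<open>The dimension of the eigenspace as a subspace of the square-integrable functions modulo
  equality almost everywhere; it is infinite if there are arbitrarily long independent families.\<close>

definition eig_multiplicity :: "real \<Rightarrow> real \<Rightarrow> real \<Rightarrow> enat" where
  "eig_multiplicity lam mu z =
     Sup {enat n | n. \<exists>f. (\<forall>i<n. f i \<in> eigenspace lam mu z) \<and> ae_independent n f}"

definition neg_eigenvalue_count :: "real \<Rightarrow> real \<Rightarrow> enat" where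
  "neg_eigenvalue_count lam mu =
     (if finite {z. z < 0 \<and> eigenvalue lam mu z}
      then \<Sum>z | z < 0 \<and> eigenvalue lam mu z. eig_multiplicity lam mu z
      else \<infinity>)"

text \<open>Nonzero solutions of the equations at the threshold, not necessarily square-integrable. The
  Bochner integral of a non-integrable function is 0 by convention, so integrability has to be
  required wherever the coefficient of the integral does not vanish.\<close>

definition even_threshold_solution :: "real \<Rightarrow> real \<Rightarrow> (real \<Rightarrow> complex) \<Rightarrow> bool" where
  "even_threshold_solution lam mu f \<longleftrightarrow>
     f \<in> borel_measurable circle \<and> even_fun f \<and> ae_nonzero f \<and>
     (mu \<noteq> 0 \<longrightarrow> integrable circle f) \<and>
     (lam \<noteq> 0 \<longrightarrow> integrable circle (\<lambda>q. of_real (cos q) * f q)) \<and>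
     (AE p in circle. H_even lam mu f p = 0)"

definition odd_threshold_solution :: "real \<Rightarrow> (real \<Rightarrow> complex) \<Rightarrow> bool" where
  "odd_threshold_solution lam f \<longleftrightarrow>
     f \<in> borel_measurable circle \<and> odd_fun f \<and> ae_nonzero f \<and>
     (lam \<noteq> 0 \<longrightarrow> integrable circle (\<lambda>q. of_real (sin q) * f q)) \<and>
     (AE p in circle. H_odd lam f p = 0)"

definition threshold_eigenvalue :: "real \<Rightarrow> real \<Rightarrow> bool" where
  "threshold_eigenvalue lam mu \<longleftrightarrow>
     (\<exists>f. even_threshold_solution lam mu f \<and> f \<in> Lspace 2) \<or>
     (\<exists>f. odd_threshold_solution lam f \<and> f \<in> Lspace 2)"

definition threshold_resonance :: "real \<Rightarrow> real \<Rightarrow> bool" where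
  "threshold_resonance lam mu \<longleftrightarrow>
     (\<exists>f. even_threshold_solution lam mu f \<and> f \<in> Lspace 1 - Lspace 2) \<or>
     (\<exists>f. odd_threshold_solution lam f \<and> f \<in> Lspace 1 - Lspace 2)"

definition super_threshold_resonance :: "real \<Rightarrow> real \<Rightarrow> bool" where
  "super_threshold_resonance lam mu \<longleftrightarrow>
     (\<exists>f. even_threshold_solution lam mu f \<and> f \<notin> Lspace 1 \<and> (\<forall>\<epsilon>. 0 < \<epsilon> \<and> \<epsilon> < 1 \<longrightarrow> f \<in> Lspace \<epsilon>)) \<or>
     (\<exists>f. odd_threshold_solution lam f \<and> f \<notin> Lspace 1 \<and> (\<forall>\<epsilon>. 0 < \<epsilon> \<and> \<epsilon> < 1 \<longrightarrow> f \<in> Lspace \<epsilon>))"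

definition H0bar :: "real \<Rightarrow> real \<Rightarrow> real" where
  "H0bar lam mu = (lam - 1) * (mu - 1) - 1"

definition lam_s :: real where
  "lam_s = 1"

definition Gamma_l :: "(real \<times> real) set" where
  "Gamma_l = {(lam, mu). H0bar lam mu = 0 \<and> lam < 1}"

definition Gamma_r :: "(real \<times> real) set" where
  "Gamma_r = {(lam, mu). H0bar lam mu = 0 \<and> lam > 1}"

definition G0 :: "(real \<times> real) set" where
  "G0 = {(lam, mu). H0bar lam mu > 0 \<and> lam < 1}"

definition G1 :: "(real \<times> real) set" where
  "G1 = {(lam, mu). H0bar lam mu < 0}"

definition G2 :: "(real \<times> real) set" where
  "G2 = {(lam, mu). H0bar lam mu > 0 \<and> lam > 1}"

definition SS_minus :: "(real \<times> real) set" where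
  "SS_minus = {(lam, mu). lam < lam_s}"

definition SS_zero :: "(real \<times> real) set" where
  "SS_zero = {(lam, mu). lam = lam_s}"

definition SS_plus :: "(real \<times> real) set" where
  "SS_plus = {(lam, mu). lam > lam_s}"

definition D :: "nat \<Rightarrow> (real \<times> real) set" where
  "D k = (if k = 0 then G0
          else if k = 1 then G1 \<inter> SS_minus
          else if k = 2 then G1 \<inter> SS_plus
          else if k = 3 then G2
          else {})"

definition B0 :: "(real \<times> real) set" where
  "B0 = Gamma_l"

definition B2 :: "(real \<times> real) set" where
  "B2 = Gamma_r"

definition S1 :: "(real \<times> real) set" where
  "S1 = SS_zero"

end

theory Submission
  imports Defs
begin

text \<open>
  The interaction has rank three, so at an energy \<open>z < 0\<close> an eigenfunction is a combination of
  \<open>1\<close>, \<open>cos\<close>, \<open>sin\<close> divided by \<open>1 - z - cos p\<close>, and its coefficients are its own first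
  trigonometric moments. Writing \<open>1 - z = (x + 1 / x) / 2\<close> with \<open>x > 1\<close> makes the moments rational
  in \<open>x\<close>, and the consistency conditions decouple: the odd sector requires \<open>x = lam\<close>, the even
  sector requires \<open>(x - lam) * ((x + 1 / x) / 2 - mu) = 1\<close>. These exclude each other and each fixes
  the eigenfunction up to a factor, so all negative eigenvalues are simple and one only has to count
  the solutions \<open>x > 1\<close>. On either side of \<open>lam\<close> the even condition has at most one, by
  monotonicity, and the sign of \<open>H0bar\<close> is that of the condition at the endpoint \<open>x = 1\<close>.

  At the threshold the equation forces \<open>f\<close> to be \<open>(a + b * cos p) / (1 - cos p)\<close> or a multiple of
  \<open>sin p / (1 - cos p)\<close>. The latter is not integrable, whence neither is \<open>1 / (1 - cos p)\<close>, and
  integrability leaves only even solutions that are constant, hence zero.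
\<close>

section \<open>Integration on the circle\<close>

lemma finite_measure_circle: "finite_measure circle"
  by (intro finite_measure_lebesgue_on bounded_set_imp_lmeasurable) auto

lemma borel_measurable_circle_of_borel:
  fixes f :: "real \<Rightarrow> 'b::topological_space"
  assumes "f \<in> borel_measurable borel"
  shows "f \<in> borel_measurable circle"
  using assms by (intro measurable_restrict_space1 measurable_completion) (simp add: measurable_lborel1)

lemma integrable_circle_mult_bounded:
  fixes f g :: "real \<Rightarrow> complex"
  assumes "integrable circle f" "g \<in> borel_measurable circle" "\<And>p. cmod (g p) \<le> K"
  shows "integrable circle (\<lambda>p. g p * f p)"
proof (rule Bochner_Integration.integrable_bound)
  show "integrable circle (\<lambda>p. of_real K * f p)" using assms by simp
  show "(\<lambda>p. g p * f p) \<in> borel_measurable circle"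
    using assms by (intro borel_measurable_times) auto
  have "cmod (g p) * cmod (f p) \<le> \<bar>K\<bar> * cmod (f p)" for p
    using order_trans[OF assms(3) abs_ge_self] by (intro mult_right_mono) auto
  then show "AE p in circle. norm (g p * f p) \<le> norm (complex_of_real K * f p)"
    by (simp add: norm_mult)
qed

text \<open>The half-open circle differs from \<open>{-pi..pi}\<close> by a null set, so a primitive
  smooth across the circle evaluates the integral. The basic integrals behind all moments are
  obtained this way.\<close>

lemma has_bochner_integral_circle_FTC:
  assumes "\<And>p. (F has_real_derivative f p) (at p)" and "continuous_on UNIV f"
  shows "has_bochner_integral circle (\<lambda>p. complex_of_real (f p)) (of_real (F pi - F (- pi)))"
proof -
  have "set_integrable lebesgue {-pi..pi} f"
    by (intro absolutely_integrable_continuous_real continuous_on_subset[OF assms(2)]) auto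
  then have "set_integrable lebesgue {-pi<..pi} f"
    by (rule set_integrable_subset) auto
  then have i: "integrable circle f"
    by (simp add: integrable_restrict_space set_integrable_def)
  have "(f has_integral F pi - F (-pi)) {-pi..pi}"
    using assms(1)
    by (intro fundamental_theorem_of_calculus)
       (auto simp: has_real_derivative_iff_has_vector_derivative[symmetric] has_field_derivative_at_within)
  then have "(f has_integral F pi - F (-pi)) {-pi<..pi}"
    by (subst has_integral_spike_set_eq[of _ "{-pi..pi}"]) (auto intro: negligible_subset[of "{-pi}"])
  then have "integral\<^sup>L circle f = F pi - F (-pi)"
    using i by (simp add: lebesgue_integral_eq_integral integral_unique)
  with i have "has_bochner_integral circle f (F pi - F (-pi))"
    by (simp add: has_bochner_integral_iff)
  then show ?thesis by (rule has_bochner_integral_of_real)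
qed

lemma AE_circle_nonzero: "AE p in circle. p \<noteq> 0"
proof -
  have "AE p in lebesgue. p \<noteq> (0::real)" by (rule AE_completion[OF AE_lborel_singleton])
  then show ?thesis by (subst AE_restrict_space_iff) auto
qed

text \<open>Lets the dispersion be cancelled at the threshold: its only zero on the circle is
  \<open>p = 0\<close>.\<close>

lemma AE_circle_cos_less_1: "AE p in circle. cos p < 1"
proof -
  have *: "cos p < 1" if p: "p \<noteq> 0" "p \<in> {-pi<..pi}" for p
  proof -
    have "cos \<bar>p\<bar> < cos 0" using p by (intro cos_monotone_0_pi) auto
    then show ?thesis by simp
  qed
  show ?thesis
    using AE_circle_nonzero by (subst (asm) AE_restrict_space_iff, simp, subst AE_restrict_space_iff, simp)
     (auto elim!: eventually_mono intro: *)
qed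

section \<open>Lebesgue spaces on the circle\<close>

lemma Lspace_1_iff: "f \<in> Lspace 1 \<longleftrightarrow> integrable circle f"
  by (auto simp: Lspace_def integrable_norm_iff)

text \<open>The circle has finite measure and x \<le> 1 + x^2. Hence eigenfunctions have moments,
  and threshold eigenvalues fall under the argument for integrable solutions.\<close>

lemma Lspace_2_imp_integrable:
  assumes "f \<in> Lspace 2" shows "integrable circle f"
proof (rule Bochner_Integration.integrable_bound)
  interpret finite_measure circle by (rule finite_measure_circle)
  show "integrable circle (\<lambda>p. 1 + cmod (f p) powr 2)"
    using assms by (auto simp: Lspace_def)
  have "x \<le> 1 + x\<^sup>2" for x :: real
  proof -
    have "2 * x \<le> x\<^sup>2 + 1"
      using zero_le_power2[of "x - 1"] by (simp add: power2_diff)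
    then show ?thesis using zero_le_power2[of x] by linarith
  qed
  then show "AE p in circle. norm (f p) \<le> norm (1 + cmod (f p) powr 2)"
    by (simp add: powr_numeral)
qed (use assms in \<open>auto simp: Lspace_def\<close>)

lemma bounded_in_Lspace_2:
  assumes "f \<in> borel_measurable circle" "\<And>p. cmod (f p) \<le> K"
  shows "f \<in> Lspace 2"
proof -
  interpret finite_measure circle by (rule finite_measure_circle)
  have "integrable circle (\<lambda>p. cmod (f p) powr 2)"
    by (rule integrable_const_bound[where B="K\<^sup>2"])
       (use assms in \<open>auto simp: powr_numeral intro!: power_mono\<close>)
  with assms show ?thesis by (auto simp: Lspace_def)
qed

section \<open>Counting the solutions of the eigenvalue equations\<close>

text \<open>With x = e^t this is cosh t. Writing w = 1 - z in this form turns the square root of w^2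
  - 1, which occurs in the resolvent integrals, into the rational expression (x - 1/x) / 2.\<close>

definition joukowski :: "real \<Rightarrow> real" where
  "joukowski x = (x + 1 / x) / 2"

lemma joukowski_eq: "x \<noteq> 0 \<Longrightarrow> 2 * x * joukowski x = x\<^sup>2 + 1"
  by (simp add: joukowski_def field_simps power2_eq_square)

lemma joukowski_strict_mono: "joukowski x < joukowski y" if "1 \<le> x" "x < y"
proof -
  have "joukowski y - joukowski x = (y - x) * (x * y - 1) / (2 * x * y)"
    using that by (simp add: joukowski_def field_simps)
  moreover have "1 < x * y" using that mult_right_mono[of 1 x y] by linarith
  ultimately have "0 < joukowski y - joukowski x"
    using that by (auto intro!: divide_pos_pos mult_pos_pos)
  then show ?thesis by simp
qed

lemma joukowski_1 [simp]: "joukowski 1 = 1"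
  by (simp add: joukowski_def)

lemma joukowski_gt_1: "1 < x \<Longrightarrow> 1 < joukowski x"
  using joukowski_strict_mono[of 1 x] by simp

text \<open>Negative energies \<open>z\<close> thus correspond one to one to parameters
  \<open>x > 1\<close> through \<open>1 - z = joukowski x\<close>.\<close>

lemma bij_betw_joukowski: "bij_betw joukowski {1<..} {1<..}"
  unfolding bij_betw_def
proof
  show "inj_on joukowski {1<..}"
    by (intro strict_mono_on_imp_inj_on strict_mono_onI joukowski_strict_mono) auto
  have "w \<in> joukowski ` {1<..}" if "w > 1" for w
  proof
    \<comment> \<open>The preimage is \<open>w + s\<close>, the larger root of x^2 - 2 w x + 1 = 0;
      the other root \<open>w - s\<close> is its inverse.\<close>
    define s where "s = sqrt (w\<^sup>2 - 1)"
    have "1 < w\<^sup>2" using that by simp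
    then have s: "s\<^sup>2 = w\<^sup>2 - 1" "s > 0" by (auto simp: s_def)
    then have "(w + s) * (w - s) = 1" by (simp add: algebra_simps power2_eq_square)
    then have "1 / (w + s) = w - s" using s that by (simp add: field_simps)
    then show "w = joukowski (w + s)" by (simp add: joukowski_def)
    show "w + s \<in> {1<..}" using s that by simp
  qed
  then show "joukowski ` {1<..} = {1<..}" by (auto intro: joukowski_gt_1)
qed

text \<open>At an energy \<open>1 - joukowski x\<close> with \<open>x > 1\<close>, the even sector has the eigenvalue equation
  \<open>secular lam mu x = 1\<close> and the odd sector has \<open>x = lam\<close>.\<close>

definition secular :: "real \<Rightarrow> real \<Rightarrow> real \<Rightarrow> real" where
  "secular lam mu x = (x - lam) * (joukowski x - mu)"

section \<open>Existence and uniqueness of roots on either side of \<open>lam\<close>\<close>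

lemma continuous_on_secular: "continuous_on {1..} (secular lam mu)"
  unfolding secular_def joukowski_def by (auto intro!: continuous_intros)

lemma secular_eq_1_right: "mu < joukowski x" if "lam < x" "secular lam mu x = 1"
  using that zero_less_mult_pos[of "x - lam" "joukowski x - mu"] by (simp add: secular_def)

text \<open>At a root to the right of \<open>lam\<close> both factors are positive, and both
  increase, so there is at most one. Existence follows from the intermediate value theorem: if
  \<open>1 < lam\<close>, the function vanishes at \<open>lam\<close>; otherwise its value at 1 is
  \<open>(lam - 1) * (mu - 1)\<close>.\<close>

lemma secular_right_root:
  "finite {x. 1 < x \<and> lam < x \<and> secular lam mu x = 1}" (is "finite ?S")
  "card {x. 1 < x \<and> lam < x \<and> secular lam mu x = 1} = (if 1 < lam \<or> (lam - 1) * (mu - 1) < 1 then 1 else 0)" (is "_ = ?n")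
proof -
  \<comment> \<open>Positivity of the second factor is required only at the upper point: if it is
    nonpositive at \<open>x\<close>, the value there is nonpositive anyway. This permits a
    comparison with the endpoint 1.\<close>
  have mono: "secular lam mu x < secular lam mu y" if "1 \<le> x" "lam \<le> x" "x < y" "mu < joukowski y" for x y
  proof -
    have J: "joukowski x < joukowski y" using that by (intro joukowski_strict_mono)
    show ?thesis
    proof (cases "joukowski x \<le> mu")
      case True
      then have "secular lam mu x \<le> 0"
        using that unfolding secular_def by (intro mult_nonneg_nonpos) auto
      moreover have "0 < secular lam mu y"
        using that unfolding secular_def by (intro mult_pos_pos) auto
      ultimately show ?thesis by simp
    next
      case False
      then show ?thesis using that J unfolding secular_def by (intro mult_strict_mono) auto
    qed
  qed
  have *: "finite ?S \<and> card ?S = ?n"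
  proof (cases "1 < lam \<or> (lam - 1) * (mu - 1) < 1")
    case True
    \<comment> \<open>\<open>a\<close> is the left end of the admissible half-line. \<open>b\<close>
      is so large that the two factors are at least 3 and 3/2, by
      \<open>b / 2 \<le> joukowski b\<close>.\<close>
    define a b where "a = max 1 lam" and "b = 2 * \<bar>mu\<bar> + \<bar>lam\<bar> + 3"
    have "secular lam mu a < 1"
      using True by (auto simp: a_def secular_def max_def algebra_simps)
    moreover have "3 * (3 / 2) \<le> secular lam mu b"
    proof -
      have "0 < b" by (simp add: b_def)
      then have "b / 2 \<le> joukowski b" by (simp add: joukowski_def field_simps)
      then have "3 / 2 \<le> joukowski b - mu" by (simp add: b_def)
      moreover have "3 \<le> b - lam" by (simp add: b_def)
      ultimately show ?thesis unfolding secular_def by (intro mult_mono) auto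
    qed
    moreover have "a \<le> b" by (auto simp: a_def b_def)
    moreover have "continuous_on {a..b} (secular lam mu)"
      by (rule continuous_on_subset[OF continuous_on_secular]) (auto simp: a_def)
    ultimately obtain x where "a \<le> x" "x \<le> b" "secular lam mu x = 1"
      using IVT'[of "secular lam mu" a 1 b] by auto
    moreover from this have "a \<noteq> x" using \<open>secular lam mu a < 1\<close> by auto
    ultimately have x: "x \<in> ?S" by (auto simp: a_def)
    have "y = x" if y: "y \<in> ?S" for y
    proof -
      have "mu < joukowski x" "mu < joukowski y"
        using x y secular_eq_1_right by auto
      then show ?thesis using x y mono[of x y] mono[of y x]
        by (cases x y rule: linorder_cases) auto
    qed
    with x have "?S = {x}" by blast
    show ?thesis unfolding \<open>?S = {x}\<close> using True by simp
  next
    case False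
    \<comment> \<open>Here \<open>lam \<le> 1\<close> and the value at 1 is at least 1, so by
      monotonicity a root would have a value above 1.\<close>
    have "?S = {}"
    proof (rule equals0I)
      fix x assume x: "x \<in> ?S"
      then have "mu < joukowski x" using secular_eq_1_right by auto
      with x have "secular lam mu 1 < secular lam mu x" using False by (intro mono) auto
      then show False using x False by (simp add: secular_def algebra_simps)
    qed
    show ?thesis unfolding \<open>?S = {}\<close> using False by simp
  qed
  show "finite ?S" by (rule conjunct1[OF *])
  show "card ?S = ?n" by (rule conjunct2[OF *])
qed

text \<open>At a root to the left of \<open>lam\<close> both factors are negative. In the form
  \<open>(lam - x) * (mu - joukowski x)\<close> the factors are positive and decreasing up to the
  root, so the root is unique and the value at 1 exceeds 1. Conversely such a value, with the zero
  at \<open>lam\<close>, yields a root in between.\<close>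

lemma secular_left_root:
  "finite {x. 1 < x \<and> x < lam \<and> secular lam mu x = 1}" (is "finite ?S")
  "card {x. 1 < x \<and> x < lam \<and> secular lam mu x = 1} = (if 1 < lam \<and> 1 < (lam - 1) * (mu - 1) then 1 else 0)" (is "_ = ?n")
proof -
  \<comment> \<open>The equation at the larger point \<open>y\<close> fixes the signs of both
    factors there, hence at every smaller point too.\<close>
  have mono: "secular lam mu y < secular lam mu x"
    if "1 \<le> x" "x < y" "y < lam" "secular lam mu y = 1" for x y
  proof -
    have "(lam - y) * (mu - joukowski y) = 1"
      using that by (simp add: secular_def algebra_simps)
    then have "joukowski y < mu"
      using that zero_less_mult_pos[of "lam - y" "mu - joukowski y"] by simp
    then have "(lam - y) * (mu - joukowski y) < (lam - x) * (mu - joukowski x)"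
      using that joukowski_strict_mono[of x y] by (intro mult_strict_mono) auto
    then show ?thesis by (simp add: secular_def algebra_simps)
  qed
  have *: "finite ?S \<and> card ?S = ?n"
  proof (cases "1 < lam \<and> 1 < (lam - 1) * (mu - 1)")
    case True
    have "secular lam mu lam \<le> 1" "1 < secular lam mu 1"
      using True by (auto simp: secular_def algebra_simps)
    moreover have "continuous_on {1..lam} (secular lam mu)"
      by (rule continuous_on_subset[OF continuous_on_secular]) auto
    ultimately obtain x where "1 \<le> x" "x \<le> lam" "secular lam mu x = 1"
      using IVT2'[of "secular lam mu" lam 1 1] True by auto
    moreover from this have "x \<noteq> 1" "x \<noteq> lam" using \<open>1 < secular lam mu 1\<close> 
      by (auto simp: secular_def)
    ultimately have x: "x \<in> ?S" by auto
    have "y = x" if "y \<in> ?S" for y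
      using x that mono[of x y] mono[of y x] by (cases x y rule: linorder_cases) auto
    with x have "?S = {x}" by blast
    show ?thesis unfolding \<open>?S = {x}\<close> using True by simp
  next
    case False
    have "?S = {}"
    proof (rule equals0I)
      fix x assume x: "x \<in> ?S"
      with mono[of 1 x] have "1 < secular lam mu 1" by simp
      then show False using x False by (simp add: secular_def algebra_simps)
    qed
    show ?thesis unfolding \<open>?S = {}\<close> using False by simp
  qed
  show "finite ?S" by (rule conjunct1[OF *])
  show "card ?S = ?n" by (rule conjunct2[OF *])
qed

text \<open>The odd root \<open>x = lam\<close> is never an even root, because
  \<open>secular\<close> vanishes there. So the roots at, right of and left of \<open>lam\<close>
  can be counted separately.\<close>

lemma secular_roots:
  "finite {x. 1 < x \<and> (x = lam \<or> secular lam mu x = 1)}" (is "finite ?X")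
  "card {x. 1 < x \<and> (x = lam \<or> secular lam mu x = 1)} =
     (if 1 < lam then 1 else 0)
   + (if 1 < lam \<or> (lam - 1) * (mu - 1) < 1 then 1 else 0)
   + (if 1 < lam \<and> 1 < (lam - 1) * (mu - 1) then 1 else 0)" (is "_ = ?n")
proof -
  let ?O = "if 1 < lam then {lam} else {}"
  let ?R = "{x. 1 < x \<and> lam < x \<and> secular lam mu x = 1}"
  let ?L = "{x. 1 < x \<and> x < lam \<and> secular lam mu x = 1}"
  have X: "?X = ?O \<union> ?R \<union> ?L"
    by (auto simp: secular_def not_less_iff_gr_or_eq)
  show "finite ?X" unfolding X using secular_right_root(1) secular_left_root(1) by simp
  have "card (?O \<union> ?R \<union> ?L) = card ?O + card ?R + card ?L"
    using secular_right_root(1) secular_left_root(1)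
    by (subst card_Un_disjoint, simp, simp, force, subst card_Un_disjoint) auto
  then show "card ?X = ?n"
    unfolding X using secular_right_root(2)[of lam mu] secular_left_root(2)[of lam mu] by simp
qed

section \<open>Eigenfunctions at negative energies\<close>

lemma joukowski_minus_cos_pos: "1 < x \<Longrightarrow> 0 < joukowski x - cos p"
  using joukowski_gt_1[of x] cos_le_one[of p] by linarith

text \<open>The primitive \<open>F\<close> integrates the Poisson kernel of radius \<open>1 / x\<close>; unlike the usual
  half-angle primitive it is smooth across the whole circle.\<close>

lemma has_bochner_integral_inverse_joukowski_minus_cos:
  assumes "1 < x"
  shows "has_bochner_integral circle (\<lambda>p. complex_of_real (1 / (joukowski x - cos p)))
           (of_real (2 * pi * (2 * x / (x\<^sup>2 - 1))))"
proof -
  \<comment> \<open>The \<open>arctan\<close> is minus the argument of x - e^(ip), that is, the sum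
    of x^(-k) sin (k p) / k over k \<ge> 1. It vanishes at both ends of the circle, so only the term
    \<open>p\<close> contributes to the integral.\<close>
  define F where "F = (\<lambda>p. 2 * x / (x\<^sup>2 - 1) * (p + 2 * arctan (sin p / (x - cos p))))"
  have x2: "1 < x\<^sup>2" using assms by simp
  have "(F has_real_derivative 1 / (joukowski x - cos p)) (at p)" for p
  proof -
    have c: "0 < x - cos p" using assms cos_le_one[of p] by linarith
    have *: "(F has_real_derivative 2 * x / (x\<^sup>2 - 1) *
           (1 + 2 * (inverse (1 + (sin p / (x - cos p))\<^sup>2) *
             ((cos p * (x - cos p) - sin p * sin p) / ((x - cos p) * (x - cos p)))))) (at p)"
      unfolding F_def using c x2 by (auto intro!: derivative_eq_intros)
    have sc: "(sin p)\<^sup>2 = 1 - (cos p)\<^sup>2" by (simp add: sin_squared_eq)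
    have d: "0 < joukowski x - cos p" by (rule joukowski_minus_cos_pos[OF assms])
    have e: "2 * x * (joukowski x - cos p) = x\<^sup>2 + 1 - 2 * x * cos p"
      using assms by (simp add: joukowski_def field_simps power2_eq_square)
    \<comment> \<open>Both sides are the squared modulus of x - e^(ip).\<close>
    have "(x - cos p)\<^sup>2 + (sin p)\<^sup>2 = 2 * x * (joukowski x - cos p)"
      unfolding e sc by (simp add: power2_eq_square algebra_simps)
    then have "inverse (1 + (sin p / (x - cos p))\<^sup>2) = (x - cos p)\<^sup>2 / (2 * x * (joukowski x - cos p))"
      using c by (simp add: field_simps)
    then have "1 + 2 * (inverse (1 + (sin p / (x - cos p))\<^sup>2) *
             ((cos p * (x - cos p) - sin p * sin p) / ((x - cos p) * (x - cos p))))
         = 1 + 2 * ((cos p * (x - cos p) - (sin p)\<^sup>2) / (2 * x * (joukowski x - cos p)))"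
      using c by (simp add: power2_eq_square)
    also have "\<dots> = (2 * x * (joukowski x - cos p) + 2 * (cos p * (x - cos p) - (sin p)\<^sup>2))
                       / (2 * x * (joukowski x - cos p))"
      using d assms by (simp add: field_simps)
    also have "\<dots> = (x\<^sup>2 - 1) / (2 * x * (joukowski x - cos p))"
      unfolding e sc by (simp add: power2_eq_square algebra_simps)
    finally show ?thesis using * x2 assms by simp
  qed
  moreover have "continuous_on UNIV (\<lambda>p. 1 / (joukowski x - cos p))"
    using less_imp_neq[OF joukowski_minus_cos_pos[OF assms]] by (auto intro!: continuous_intros)
  ultimately have "has_bochner_integral circle (\<lambda>p. complex_of_real (1 / (joukowski x - cos p)))
     (of_real (F pi - F (- pi)))"
    by (rule has_bochner_integral_circle_FTC)
  moreover have "F pi - F (- pi) = 2 * pi * (2 * x / (x\<^sup>2 - 1))"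
    by (simp add: F_def algebra_simps)
  ultimately show ?thesis by simp
qed

text \<open>The integrand has the periodic primitive
  \<open>ln (joukowski x - cos p)\<close>.\<close>

lemma has_bochner_integral_sin_over_joukowski_minus_cos:
  assumes "1 < x"
  shows "has_bochner_integral circle (\<lambda>p. complex_of_real (sin p / (joukowski x - cos p))) 0"
proof -
  have "has_bochner_integral circle (\<lambda>p. complex_of_real (sin p / (joukowski x - cos p)))
      (of_real (ln (joukowski x - cos pi) - ln (joukowski x - cos (- pi))))"
    using joukowski_minus_cos_pos[OF assms] less_imp_neq[OF joukowski_minus_cos_pos[OF assms]]
    by (intro has_bochner_integral_circle_FTC)
       (auto intro!: derivative_eq_intros continuous_intros)
  then show ?thesis by simp
qed

lemma has_bochner_integral_circle_trig:
  "has_bochner_integral circle (\<lambda>p. 1 :: complex) (of_real (2 * pi))"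
  "has_bochner_integral circle (\<lambda>p. complex_of_real (cos p)) 0"
  "has_bochner_integral circle (\<lambda>p. complex_of_real (sin p)) 0"
proof -
  show "has_bochner_integral circle (\<lambda>p. 1 :: complex) (of_real (2 * pi))"
    using has_bochner_integral_circle_FTC[of "\<lambda>p. p" "\<lambda>p. 1"] by simp
  show "has_bochner_integral circle (\<lambda>p. complex_of_real (cos p)) 0"
    using has_bochner_integral_circle_FTC[of sin cos] by (simp add: continuous_intros)
  have "((\<lambda>p. - cos p) has_real_derivative sin p) (at p)" for p
    by (auto intro!: derivative_eq_intros)
  then show "has_bochner_integral circle (\<lambda>p. complex_of_real (sin p)) 0"
    using has_bochner_integral_circle_FTC[of "\<lambda>p. - cos p" sin] by (simp add: continuous_intros)
qed

text \<open>The multiplication operator \<open>dispersion - z\<close> with \<open>z = 1 - joukowski x\<close> is multiplication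
  by \<open>joukowski x - cos p\<close>.\<close>

definition trig_resolvent :: "real \<Rightarrow> complex \<Rightarrow> complex \<Rightarrow> complex \<Rightarrow> real \<Rightarrow> complex" where
  "trig_resolvent x a b c p =
     (a + b * of_real (cos p) + c * of_real (sin p)) / of_real (joukowski x - cos p)"

text \<open>Multiplying the kernel \<open>1 / (joukowski x - cos p)\<close> by \<open>cos p\<close>
  gives \<open>joukowski x\<close> times the kernel, minus 1. With sin^2 = 1 - cos^2 this reduces
  every integrand to the kernel, the kernel times sine, and trigonometric polynomials of degree one.
  The first two moments involve only \<open>a\<close> and \<open>b\<close>, the third only
  \<open>c\<close>: the parities decouple.\<close>

lemma trig_resolvent_moments:
  fixes a b c :: complex
  assumes "1 < x"
  defines "g \<equiv> trig_resolvent x a b c"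
    and "m \<equiv> (of_real x * a + b) * of_real (2 / (x\<^sup>2 - 1))"
  shows "has_bochner_integral circle g (of_real (2 * pi) * m)"
    and "has_bochner_integral circle (\<lambda>p. of_real (cos p) * g p)
           (of_real (2 * pi) * (of_real (joukowski x) * m - a))"
    and "has_bochner_integral circle (\<lambda>p. of_real (sin p) * g p) (of_real (2 * pi) * c / of_real x)"
proof -
  define w where "w = joukowski x"
  have x2: "1 < x\<^sup>2" using assms(1) by simp
  define k where "k = (\<lambda>p. complex_of_real (1 / (w - cos p)))"
  have k: "k p * of_real (cos p) = of_real w * k p - 1" for p
  proof -
    have "1 / (w - cos p) * cos p = w * (1 / (w - cos p)) - 1"
      using joukowski_minus_cos_pos[OF assms(1), of p] by (simp add: w_def field_simps)
    from arg_cong[OF this, of complex_of_real] show ?thesis by (simp add: k_def)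
  qed
  have s: "complex_of_real (sin p) * of_real (sin p) = 1 - of_real (cos p) * of_real (cos p)" for p
  proof -
    have "sin p * sin p = 1 - cos p * cos p"
      using sin_cos_squared_add[of p] by (simp add: power2_eq_square)
    from arg_cong[OF this, of complex_of_real] show ?thesis by simp
  qed
  have gk: "g p = (a + b * of_real (cos p) + c * of_real (sin p)) * k p" for p
    by (simp add: g_def trig_resolvent_def k_def w_def)
  have I: "has_bochner_integral circle k (of_real (2 * pi * (2 * x / (x\<^sup>2 - 1))))"
    using has_bochner_integral_inverse_joukowski_minus_cos[OF assms(1)] by (simp add: k_def w_def)
  have J: "has_bochner_integral circle (\<lambda>p. of_real (sin p) * k p) 0"
    using has_bochner_integral_sin_over_joukowski_minus_cos[OF assms(1)] by (simp add: k_def w_def)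
  have lin: "has_bochner_integral circle
      (\<lambda>p. u * k p + v * (of_real (sin p) * k p) + (s * 1 + t * of_real (cos p) + r * of_real (sin p)))
      (u * of_real (2 * pi * (2 * x / (x\<^sup>2 - 1))) + v * 0 + (s * of_real (2 * pi) + t * 0 + r * 0))"
    for u v s t r
    by (intro has_bochner_integral_add has_bochner_integral_mult_right I J
          has_bochner_integral_circle_trig)
  have w: "w = (x\<^sup>2 + 1) / (2 * x)"
    using assms(1) by (simp add: w_def joukowski_def field_simps power2_eq_square)
  have x0: "complex_of_real x \<noteq> 0" using assms(1) by simp
  define \<beta> where "\<beta> = complex_of_real (2 / (x\<^sup>2 - 1))"
  have \<alpha>: "complex_of_real (2 * pi * (2 * x / (x\<^sup>2 - 1))) = of_real (2 * pi) * (of_real x * \<beta>)"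
    by (simp add: \<beta>_def)
  have "w * (x * (2 / (x\<^sup>2 - 1))) = 1 + 2 / (x\<^sup>2 - 1)"
    unfolding w using assms(1) less_imp_neq[OF x2] by (simp add: divide_simps) (simp add: algebra_simps)
  from arg_cong[OF this, of complex_of_real]
  have w\<alpha>: "of_real w * (of_real x * \<beta>) = 1 + \<beta>" by (simp add: \<beta>_def)
  have "x * ((x - w) * (2 / (x\<^sup>2 - 1))) = 1"
    unfolding w using assms(1) less_imp_neq[OF x2]
    by (simp add: divide_simps) (simp add: algebra_simps power2_eq_square)
  from arg_cong[OF this, of complex_of_real]
  have x\<beta>: "of_real x * ((of_real x - of_real w) * \<beta>) = 1" by (simp add: \<beta>_def)
  show "has_bochner_integral circle g (of_real (2 * pi) * m)"
  proof (rule has_bochner_integral_cong[THEN iffD1, OF refl _ _ lin])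
    show "(a + b * of_real w) * k p + c * (of_real (sin p) * k p)
        + ((- b) * 1 + 0 * of_real (cos p) + 0 * of_real (sin p)) = g p" for p
      using k[of p] unfolding gk by algebra
    show "(a + b * of_real w) * of_real (2 * pi * (2 * x / (x\<^sup>2 - 1))) + c * 0
        + ((- b) * of_real (2 * pi) + 0 * 0 + 0 * 0) = of_real (2 * pi) * m"
      using w\<alpha> unfolding \<alpha> m_def \<beta>_def[symmetric] by algebra
  qed
  show "has_bochner_integral circle (\<lambda>p. of_real (cos p) * g p)
           (of_real (2 * pi) * (of_real (joukowski x) * m - a))"
  proof (rule has_bochner_integral_cong[THEN iffD1, OF refl _ _ lin])
    show "((a + b * of_real w) * of_real w) * k p + (c * of_real w) * (of_real (sin p) * k p)
        + ((- a - b * of_real w) * 1 + (- b) * of_real (cos p) + (- c) * of_real (sin p))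
        = of_real (cos p) * g p" for p
      using k[of p] unfolding gk by algebra
    show "((a + b * of_real w) * of_real w) * of_real (2 * pi * (2 * x / (x\<^sup>2 - 1)))
        + (c * of_real w) * 0 + ((- a - b * of_real w) * of_real (2 * pi) + (- b) * 0 + (- c) * 0)
        = of_real (2 * pi) * (of_real (joukowski x) * m - a)"
      using w\<alpha> unfolding \<alpha> m_def \<beta>_def[symmetric] w_def[symmetric] by algebra
  qed
  show "has_bochner_integral circle (\<lambda>p. of_real (sin p) * g p) (of_real (2 * pi) * c / of_real x)"
  proof (rule has_bochner_integral_cong[THEN iffD1, OF refl _ _ lin])
    show "(c - c * of_real w * of_real w) * k p + (a + b * of_real w) * (of_real (sin p) * k p)
        + (c * of_real w * 1 + c * of_real (cos p) + (- b) * of_real (sin p))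
        = of_real (sin p) * g p" for p
      using k[of p] s[of p] unfolding gk by algebra
    show "(c - c * of_real w * of_real w) * of_real (2 * pi * (2 * x / (x\<^sup>2 - 1)))
        + (a + b * of_real w) * 0 + (c * of_real w * of_real (2 * pi) + c * 0 + (- b) * 0)
        = of_real (2 * pi) * c / of_real x"
      using w\<alpha> x\<beta> x0 unfolding \<alpha> nonzero_eq_divide_eq[OF x0] by algebra
  qed
qed

section \<open>The eigenvalue equation in terms of moments\<close>

lemma borel_measurable_circle_trig:
  "(\<lambda>p. complex_of_real (cos p)) \<in> borel_measurable circle"
  "(\<lambda>p. complex_of_real (sin p)) \<in> borel_measurable circle"
  by (intro borel_measurable_circle_of_borel; measurable)+

lemma integrable_circle_mult_trig:
  fixes f :: "real \<Rightarrow> complex"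
  assumes "integrable circle f"
  shows "integrable circle (\<lambda>p. of_real (cos p) * f p)"
    and "integrable circle (\<lambda>p. of_real (sin p) * f p)"
  by (rule integrable_circle_mult_bounded[OF assms, where K = 1];
      simp add: borel_measurable_circle_trig)+

text \<open>The addition theorem for \<open>cos (p - s)\<close> splits the interaction into three
  rank-one terms, and integrability of \<open>f\<close> makes the three moments converge
  separately.\<close>

lemma H_eq:
  assumes "integrable circle f"
  shows "H lam mu f p = of_real (1 - cos p) * f p
    - (of_real mu * (LINT s|circle. f s)
       + of_real lam * of_real (cos p) * (LINT s|circle. of_real (cos s) * f s)
       + of_real lam * of_real (sin p) * (LINT s|circle. of_real (sin s) * f s)) / of_real (2 * pi)"
proof -
  note [simp] = assms integrable_circle_mult_trig[OF assms]
  have "(LINT s|circle. of_real (mu + lam * cos (p - s)) * f s)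
    = (LINT s|circle. of_real mu * f s + (of_real lam * of_real (cos p)) * (of_real (cos s) * f s)
        + (of_real lam * of_real (sin p)) * (of_real (sin s) * f s))"
    by (intro Bochner_Integration.integral_cong refl) (simp add: cos_diff algebra_simps)
  also have "\<dots> = of_real mu * (LINT s|circle. f s)
       + of_real lam * of_real (cos p) * (LINT s|circle. of_real (cos s) * f s)
       + of_real lam * of_real (sin p) * (LINT s|circle. of_real (sin s) * f s)"
    by (simp add: Bochner_Integration.integral_add)
  finally show ?thesis by (simp add: H_def dispersion_def)
qed

lemma borel_measurable_trig_resolvent: "trig_resolvent x a b c \<in> borel_measurable circle"
  unfolding trig_resolvent_def by (intro borel_measurable_circle_of_borel) measurable

lemma trig_resolvent_bounded:
  assumes "1 < x"
  shows "cmod (trig_resolvent x a b c p) \<le> (cmod a + cmod b + cmod c) / (joukowski x - 1)"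
proof -
  have "cmod (a + b * of_real (cos p) + c * of_real (sin p)) \<le> cmod a + cmod b + cmod c"
    by (intro order_trans[OF norm_triangle_ineq] add_mono)
       (auto simp: norm_mult intro!: mult_left_le)
  then show ?thesis
    using joukowski_gt_1[OF assms] cos_le_one[of p]
      abs_of_pos[OF joukowski_minus_cos_pos[OF assms, of p]]
    by (auto simp: trig_resolvent_def norm_divide simp flip: of_real_diff intro!: frac_le)
qed

lemma trig_resolvent_in_Lspace_2: "1 < x \<Longrightarrow> trig_resolvent x a b c \<in> Lspace 2"
  by (rule bounded_in_Lspace_2[OF borel_measurable_trig_resolvent trig_resolvent_bounded])

text \<open>\<open>m\<close> and \<open>n\<close> are the prescribed mean and sine moment,
  normalized by \<open>2 * pi\<close>; the cosine moment is then
  \<open>(joukowski x - mu) * m\<close>. The two product conditions say that the function built from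
  these moments really has them. The product form treats both sectors at once, since either moment
  may vanish.\<close>

lemma trig_resolvent_eigenfunction:
  assumes "1 < x"
    and "a = of_real mu * m" "b = of_real lam * of_real (joukowski x - mu) * m" "c = of_real lam * n"
    and "m * (of_real (secular lam mu x) - 1) = 0" "n * (of_real x - of_real lam) = 0"
  shows "trig_resolvent x a b c \<in> eigenspace lam mu (1 - joukowski x)"
    and "(LINT p|circle. trig_resolvent x a b c p) = of_real (2 * pi) * m"
    and "(LINT p|circle. of_real (sin p) * trig_resolvent x a b c p) = of_real (2 * pi) * n"
proof -
  let ?g = "trig_resolvent x a b c"
  note I = trig_resolvent_moments[OF assms(1), of a b c, unfolded has_bochner_integral_iff]
  have x0: "complex_of_real x \<noteq> 0" using assms(1) by simp
  have "1 < x\<^sup>2" using assms(1) by simp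
  then have x1: "(complex_of_real x)\<^sup>2 \<noteq> 1"
    by (metis less_irrefl of_real_eq_1_iff of_real_power)
  have w: "2 * complex_of_real x * of_real (joukowski x) = (of_real x)\<^sup>2 + 1"
    using arg_cong[OF joukowski_eq[of x], of complex_of_real] assms(1) by simp
  have s: "m * ((of_real x - of_real lam) * (of_real (joukowski x) - of_real mu) - 1) = 0"
    using assms(5) by (simp add: secular_def)
  \<comment> \<open>Let w = \<open>joukowski x\<close>. Since x^2 - 1 = 2 (x w - 1), this is
    \<open>m\<close> times the identity x mu + lam (w - mu) = x w - 1, a rearrangement of (x - lam)
    (w - mu) = 1.\<close>
  have m: "(of_real x * a + b) * of_real (2 / (x\<^sup>2 - 1)) = m"
  proof -
    have "(of_real x * a + b) * 2 = m * ((of_real x)\<^sup>2 - 1)"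
      using s w unfolding assms(2,3) of_real_diff by algebra
    then show ?thesis using x1 by (simp add: field_simps)
  qed
  have n: "c / of_real x = n"
    using x0 assms(4,6) by (auto simp: field_simps)
  have I0: "(LINT p|circle. ?g p) = of_real (2 * pi) * m" by (rule conjunct2[OF I(1)[unfolded m]])
  have I1: "(LINT p|circle. of_real (cos p) * ?g p) = of_real (2 * pi) * (of_real (joukowski x) * m - a)"
    by (rule conjunct2[OF I(2)[unfolded m]])
  have I2: "(LINT p|circle. of_real (sin p) * ?g p) = of_real (2 * pi) * n"
    using I(3) by (simp add: n[symmetric])
  show "(LINT p|circle. ?g p) = of_real (2 * pi) * m"
    and "(LINT p|circle. of_real (sin p) * ?g p) = of_real (2 * pi) * n"
    by (fact I0 I2)+
  have "H lam mu ?g p = of_real (1 - joukowski x) * ?g p" for p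
  proof -
    have "H lam mu ?g p = of_real (1 - cos p) * ?g p - (a + b * of_real (cos p) + c * of_real (sin p))"
    proof -
      have "(of_real mu * (of_real (2 * pi) * m)
           + of_real lam * of_real (cos p) * (of_real (2 * pi) * (of_real (joukowski x) * m - a))
           + of_real lam * of_real (sin p) * (of_real (2 * pi) * n)) / of_real (2 * pi)
          = a + b * of_real (cos p) + c * of_real (sin p)"
        by (simp add: assms(2-4) add_divide_distrib) (simp add: algebra_simps)
      then show ?thesis unfolding H_eq[OF conjunct1[OF I(1)]] I0 I1 I2 by (rule arg_cong)
    qed
    also have "a + b * of_real (cos p) + c * of_real (sin p) = of_real (joukowski x - cos p) * ?g p"
      using joukowski_minus_cos_pos[OF assms(1), of p] by (simp add: trig_resolvent_def)
    finally show ?thesis by (simp add: left_diff_distrib)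
  qed
  then show "?g \<in> eigenspace lam mu (1 - joukowski x)"
    using trig_resolvent_in_Lspace_2[OF assms(1)] by (simp add: eigenspace_def)
qed

text \<open>Dividing by the positive function \<open>joukowski x - cos p\<close> recovers
  \<open>f\<close> from its own three moments. Recomputing these moments gives three linear
  equations: one expresses the cosine moment through \<open>m\<close>, and the other two become the
  product conditions.\<close>

lemma eigenspace_imp_trig_resolvent:
  assumes "1 < x" and f: "f \<in> eigenspace lam mu (1 - joukowski x)"
  obtains m n where "m * (of_real (secular lam mu x) - 1) = 0" "n * (of_real x - of_real lam) = 0"
    "AE p in circle. f p = trig_resolvent x (of_real mu * m)
        (of_real lam * of_real (joukowski x - mu) * m) (of_real lam * n) p"
proof -
  define m l n where "m = (LINT s|circle. f s) / of_real (2 * pi)"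
    and "l = (LINT s|circle. of_real (cos s) * f s) / of_real (2 * pi)"
    and "n = (LINT s|circle. of_real (sin s) * f s) / of_real (2 * pi)"
  note mln = m_def l_def n_def
  define g where "g = trig_resolvent x (of_real mu * m) (of_real lam * l) (of_real lam * n)"
  note I = trig_resolvent_moments[OF assms(1), of "of_real mu * m" "of_real lam * l" "of_real lam * n",
     folded g_def, unfolded has_bochner_integral_iff]
  have int: "integrable circle f"
    using f by (intro Lspace_2_imp_integrable) (simp add: eigenspace_def)
  have ae: "AE p in circle. H lam mu f p = of_real (1 - joukowski x) * f p"
    using f by (simp add: eigenspace_def)
  have "f p = g p" if "H lam mu f p = of_real (1 - joukowski x) * f p" for p
  proof -
    have "of_real (joukowski x - cos p) * f p
        = of_real mu * m + of_real lam * l * of_real (cos p) + of_real lam * n * of_real (sin p)"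
      using that unfolding H_eq[OF int] mln
      by (simp add: left_diff_distrib add_divide_distrib) (simp add: algebra_simps)
    moreover have "complex_of_real (joukowski x - cos p) \<noteq> 0"
      using joukowski_minus_cos_pos[OF assms(1), of p] by (metis less_irrefl of_real_eq_0_iff)
    ultimately show ?thesis
      unfolding g_def trig_resolvent_def by (metis nonzero_mult_div_cancel_left)
  qed
  with ae have fg: "AE p in circle. f p = g p" by (auto elim: eventually_mono)
  have mg: "f \<in> borel_measurable circle" "g \<in> borel_measurable circle"
    using int by (auto simp: g_def borel_measurable_trig_resolvent)
  \<comment> \<open>\<open>g\<close> is built from the moments of \<open>f\<close> and agrees with
    \<open>f\<close> almost everywhere, so its moments must be the same ones.\<close>
  have m: "m = (LINT s|circle. g s) / of_real (2 * pi)"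
    unfolding m_def by (intro arg_cong2[where f = "(/)"] integral_cong_AE fg mg refl)
  have l: "l = (LINT s|circle. of_real (cos s) * g s) / of_real (2 * pi)"
    unfolding l_def using fg
    by (intro arg_cong2[where f = "(/)"] integral_cong_AE borel_measurable_times mg
         borel_measurable_circle_trig refl) auto
  have n: "n = (LINT s|circle. of_real (sin s) * g s) / of_real (2 * pi)"
    unfolding n_def using fg
    by (intro arg_cong2[where f = "(/)"] integral_cong_AE borel_measurable_times mg
         borel_measurable_circle_trig refl) auto
  have x0: "complex_of_real x \<noteq> 0" using assms(1) by simp
  have "1 < x\<^sup>2" using assms(1) by simp
  then have x1: "(complex_of_real x)\<^sup>2 \<noteq> 1"
    by (metis less_irrefl of_real_eq_1_iff of_real_power)
  have w: "2 * complex_of_real x * of_real (joukowski x) = (of_real x)\<^sup>2 + 1"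
    using arg_cong[OF joukowski_eq[of x], of complex_of_real] assms(1) by simp
  have m': "m = (of_real x * (of_real mu * m) + of_real lam * l) * of_real (2 / (x\<^sup>2 - 1))"
    using m I(1) by simp
  have l': "l = of_real (joukowski x - mu) * m"
  proof -
    have "l = of_real (joukowski x) * m - of_real mu * m"
      using l conjunct2[OF I(2)[unfolded m'[symmetric]]] by simp
    then show ?thesis by (simp add: algebra_simps)
  qed
  have n': "n = of_real lam * n / of_real x"
    using n I(3) by simp
  have "m * ((of_real x)\<^sup>2 - 1) = (of_real x * (of_real mu * m) + of_real lam * l) * 2"
    using m' x1 by (simp add: field_simps)
  then have "m * (of_real (secular lam mu x) - 1) = 0"
    using w unfolding l' secular_def of_real_diff of_real_mult by algebra
  moreover have "n * (of_real x - of_real lam) = 0"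
    using n' x0 by (simp add: field_simps)
  ultimately show ?thesis
    using fg that[of m n] unfolding g_def l' mult.assoc by blast
qed

text \<open>Shows explicit eigenfunctions to be nontrivial by a nonzero moment, without examining
  when their coefficients vanish.\<close>

lemma ae_nonzero_if_integral_nonzero:
  assumes "(LINT p|circle. g p * f p) \<noteq> 0" shows "ae_nonzero f"
  unfolding ae_nonzero_def
proof
  assume "AE p in circle. f p = 0"
  then have "AE p in circle. g p * f p = 0" by (auto elim: eventually_mono)
  then have "(LINT p|circle. g p * f p) = 0" by (rule integral_eq_zero_AE)
  with assms show False by contradiction
qed

lemma trig_resolvent_scale: "trig_resolvent x (a * k) (b * k) (c * k) p = k * trig_resolvent x a b c p"
  by (simp add: trig_resolvent_def algebra_simps)

text \<open>At \<open>x = lam\<close> the value of \<open>secular\<close> is 0, not 1, which forces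
  \<open>m = 0\<close> and leaves only the sine part. At any other root
  \<open>x \<noteq> lam\<close> forces \<open>n = 0\<close>. Either way one free scalar
  remains.\<close>

lemma eigenspace_one_dimensional:
  assumes "1 < x" "x = lam \<or> secular lam mu x = 1"
  obtains f where "f \<in> eigenspace lam mu (1 - joukowski x)" "ae_nonzero f"
    "\<And>g. g \<in> eigenspace lam mu (1 - joukowski x) \<Longrightarrow> \<exists>k. AE p in circle. g p = k * f p"
proof (cases "x = lam")
  case True
  then have s: "secular lam mu x = 0" by (simp add: secular_def)
  let ?f = "trig_resolvent x 0 0 (of_real lam)"
  note E = trig_resolvent_eigenfunction[OF assms(1), of 0 mu 0 0 lam "of_real lam" 1]
  show ?thesis
  proof (rule that)
    show "?f \<in> eigenspace lam mu (1 - joukowski x)" using True by (intro E(1)) auto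
    have "(LINT p|circle. of_real (sin p) * ?f p) = of_real (2 * pi) * 1"
      using True by (intro E(3)) auto
    then show "ae_nonzero ?f" 
      using ae_nonzero_if_integral_nonzero[of "\<lambda>p. of_real (sin p)" ?f] by simp
    fix g assume "g \<in> eigenspace lam mu (1 - joukowski x)"
    then obtain m n where "m * (of_real (secular lam mu x) - 1) = 0" and
      *: "AE p in circle. g p = trig_resolvent x (of_real mu * m)
        (of_real lam * of_real (joukowski x - mu) * m) (of_real lam * n) p"
      by (rule eigenspace_imp_trig_resolvent[OF assms(1)])
    then have "m = 0" using s by simp
    with * have "AE p in circle. g p = n * ?f p"
      using trig_resolvent_scale[of x 0 n 0 "of_real lam"] by simp
    then show "\<exists>k. AE p in circle. g p = k * ?f p" ..
  qed
next
  case False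
  then have s: "secular lam mu x = 1" using assms(2) by simp
  let ?f = "trig_resolvent x (of_real mu) (of_real lam * of_real (joukowski x - mu)) 0"
  note E = trig_resolvent_eigenfunction[OF assms(1), of "of_real mu" mu 1
      "of_real lam * of_real (joukowski x - mu)" lam 0 0]
  show ?thesis
  proof (rule that)
    show "?f \<in> eigenspace lam mu (1 - joukowski x)" using s by (intro E(1)) auto
    have "(LINT p|circle. ?f p) = of_real (2 * pi) * 1"
      using s by (intro E(2)) auto
    then show "ae_nonzero ?f"
      using ae_nonzero_if_integral_nonzero[of "\<lambda>_. 1" ?f] by simp
    fix g assume "g \<in> eigenspace lam mu (1 - joukowski x)"
    then obtain m n where "n * (of_real x - of_real lam) = 0" and
      *: "AE p in circle. g p = trig_resolvent x (of_real mu * m)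
        (of_real lam * of_real (joukowski x - mu) * m) (of_real lam * n) p"
      by (rule eigenspace_imp_trig_resolvent[OF assms(1)])
    then have "n = 0" using False by simp
    with * have "AE p in circle. g p = m * ?f p"
      using trig_resolvent_scale[of x "of_real mu" m "of_real lam * of_real (joukowski x - mu)" 0] by simp
    then show "\<exists>k. AE p in circle. g p = k * ?f p" ..
  qed
qed

section \<open>Negative eigenvalues and their multiplicities\<close>

lemma eigenvalue_iff:
  assumes "1 < x"
  shows "eigenvalue lam mu (1 - joukowski x) \<longleftrightarrow> x = lam \<or> secular lam mu x = 1"
proof
  assume "x = lam \<or> secular lam mu x = 1"
  then show "eigenvalue lam mu (1 - joukowski x)"
    using eigenspace_one_dimensional[OF assms, of lam mu] unfolding eigenvalue_def by metis
next
  assume "eigenvalue lam mu (1 - joukowski x)"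
  then obtain f where f: "f \<in> eigenspace lam mu (1 - joukowski x)" "ae_nonzero f"
    by (auto simp: eigenvalue_def)
  show "x = lam \<or> secular lam mu x = 1"
  proof (rule ccontr)
    assume "\<not> (x = lam \<or> secular lam mu x = 1)"
    then have ne: "complex_of_real x - of_real lam \<noteq> 0" "complex_of_real (secular lam mu x) - 1 \<noteq> 0"
      by auto
    obtain m n where "m * (of_real (secular lam mu x) - 1) = 0" "n * (of_real x - of_real lam) = 0"
      and *: "AE p in circle. f p = trig_resolvent x (of_real mu * m)
        (of_real lam * of_real (joukowski x - mu) * m) (of_real lam * n) p"
      by (rule eigenspace_imp_trig_resolvent[OF assms f(1)])
    with ne have "m = 0" "n = 0" by (metis mult_eq_0_iff)+
    with * have "AE p in circle. f p = 0" by (simp add: trig_resolvent_def)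
    with f(2) show False by (simp add: ae_nonzero_def)
  qed
qed

text \<open>Any two members are multiples of \<open>f\<close> and hence dependent, while
  \<open>f\<close> alone is an independent family of length 1.\<close>

lemma eig_multiplicity_eq_1:
  assumes f: "f \<in> eigenspace lam mu z" "ae_nonzero f"
    and dim: "\<And>g. g \<in> eigenspace lam mu z \<Longrightarrow> \<exists>k. AE p in circle. g p = k * f p"
  shows "eig_multiplicity lam mu z = 1"
  unfolding eig_multiplicity_def
proof (rule antisym)
  have "n \<le> 1" if g: "\<forall>i<n. g i \<in> eigenspace lam mu z" "ae_independent n g" for n g
  proof (rule ccontr)
    assume "\<not> n \<le> 1"
    then have n: "{0, 1} \<subseteq> {..<n}" "1 < n" by auto
    obtain k0 k1 where k: "AE p in circle. g 0 p = k0 * f p" "AE p in circle. g 1 p = k1 * f p"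
      using g(1) dim n by (metis lessThan_iff insert_subset)
    \<comment> \<open>If \<open>k0 = 0\<close>, the first function is null by itself. Otherwise
      \<open>k1 * g 0 p - k0 * g 1 p\<close> vanishes almost everywhere, with the nonzero
      coefficient \<open>- k0\<close>.\<close>
    define c :: "nat \<Rightarrow> complex"
      where "c = (if k0 = 0 then (\<lambda>i. if i = 0 then 1 else 0)
                  else (\<lambda>i. if i = 0 then k1 else if i = 1 then - k0 else 0))"
    have c: "(\<Sum>i<n. c i * g i p) = c 0 * g 0 p + c 1 * g 1 p" for p
    proof -
      have "(\<Sum>i<n. c i * g i p) = (\<Sum>i\<in>{0, 1}. c i * g i p)"
        by (rule sum.mono_neutral_right) (use n in \<open>auto simp: c_def\<close>)
      then show ?thesis by simp
    qed
    have "AE p in circle. (\<Sum>i<n. c i * g i p) = 0"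
      using k by eventually_elim (auto simp: c, auto simp: c_def)
    then have "\<forall>i<n. c i = 0" using g(2) by (simp add: ae_independent_def)
    then have "c 0 = 0" "c 1 = 0" using n by auto
    then show False by (auto simp: c_def split: if_splits)
  qed
  then show "Sup {enat n |n. \<exists>f. (\<forall>i<n. f i \<in> eigenspace lam mu z) \<and> ae_independent n f} \<le> 1"
    by (intro Sup_least) (auto simp: one_enat_def)
  have "ae_independent 1 (\<lambda>_. f)"
    unfolding ae_independent_def
  proof (intro allI impI)
    fix c :: "nat \<Rightarrow> complex" and i :: nat
    assume "AE p in circle. (\<Sum>i<1. c i * f p) = 0" and i: "i < 1"
    then have "AE p in circle. c 0 * f p = 0" by simp
    moreover have "\<not> (AE p in circle. f p = 0)" using f(2) by (simp add: ae_nonzero_def)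
    ultimately have "c 0 = 0" by (cases "c 0 = 0") auto
    then show "c i = 0" using i by simp
  qed
  then show "1 \<le> Sup {enat n |n. \<exists>f. (\<forall>i<n. f i \<in> eigenspace lam mu z) \<and> ae_independent n f}"
    using f(1) by (intro Sup_upper) (auto simp: one_enat_def intro!: exI[of _ "1::nat"])
qed

text \<open>The bijection \<open>joukowski\<close> carries the roots to the eigenvalues, and
  simplicity turns the sum of multiplicities into a cardinality.\<close>

lemma neg_eigenvalue_count_eq:
  "neg_eigenvalue_count lam mu =
     enat (card {x. 1 < x \<and> (x = lam \<or> secular lam mu x = 1)})"
proof -
  let ?X = "{x. 1 < x \<and> (x = lam \<or> secular lam mu x = 1)}"
  let ?Z = "{z. z < 0 \<and> eigenvalue lam mu z}"
  have Z: "?Z = (\<lambda>x. 1 - joukowski x) ` ?X"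
  proof (intro equalityI subsetI)
    fix z assume z: "z \<in> ?Z"
    then have "1 - z \<in> joukowski ` {1<..}"
      using bij_betw_joukowski by (simp add: bij_betw_def)
    then obtain x where "1 < x" "z = 1 - joukowski x" by auto
    then show "z \<in> (\<lambda>x. 1 - joukowski x) ` ?X"
      using z eigenvalue_iff[of x lam mu] by auto
  next
    fix z assume "z \<in> (\<lambda>x. 1 - joukowski x) ` ?X"
    then show "z \<in> ?Z" using eigenvalue_iff joukowski_gt_1 by auto
  qed
  have inj: "inj_on (\<lambda>x. 1 - joukowski x) ?X"
    using bij_betw_joukowski by (auto simp: bij_betw_def inj_on_def)
  have fin: "finite ?Z" unfolding Z using secular_roots(1) by (rule finite_imageI)
  have "eig_multiplicity lam mu z = 1" if z: "z \<in> ?Z" for z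
  proof -
    obtain x where x: "1 < x" "x = lam \<or> secular lam mu x = 1" "z = 1 - joukowski x"
      using z unfolding Z by auto
    show ?thesis
      unfolding x(3) by (rule eigenspace_one_dimensional[OF x(1,2)]) (rule eig_multiplicity_eq_1)
  qed
  then have "neg_eigenvalue_count lam mu = (\<Sum>z\<in>?Z. 1)"
    using fin by (simp add: neg_eigenvalue_count_def)
  also have "\<dots> = enat (card ?Z)" by (simp add: of_nat_eq_enat)
  also have "card ?Z = card ?X" unfolding Z by (rule card_image[OF inj])
  finally show ?thesis .
qed

section \<open>The threshold\<close>

text \<open>The function is cot (p / 2), and its primitive \<open>ln (1 - cos p)\<close> diverges at
  0.\<close>

lemma cot_half_not_integrable: "\<not> integrable circle (\<lambda>p. complex_of_real (sin p / (1 - cos p)))"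
proof
  assume "integrable circle (\<lambda>p. complex_of_real (sin p / (1 - cos p)))"
  then have "integrable circle (\<lambda>p. \<bar>sin p / (1 - cos p)\<bar>)"
    unfolding norm_of_real[symmetric, where 'a = complex] by (rule integrable_norm)
  then have i: "(\<lambda>p. \<bar>sin p / (1 - cos p)\<bar>) integrable_on {-pi<..pi}"
    by (rule integrable_on_lebesgue_on) auto
  define K where "K = integral {-pi<..pi} (\<lambda>p. \<bar>sin p / (1 - cos p)\<bar>)"
  have "0 \<le> K" unfolding K_def by (rule integral_nonneg[OF i]) auto
  \<comment> \<open>The cutoff satisfies \<open>ln (1 - cos e) = - (K + 1)\<close>, so the integral
    over \<open>{e..pi}\<close> alone is \<open>ln 2 + (K + 1)\<close>, more than the supposed total
    \<open>K\<close>.\<close>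
  define t where "t = exp (- (K + 1))"
  define e where "e = arccos (1 - t)"
  have t: "0 < t" "t < 1" using \<open>0 \<le> K\<close> by (auto simp: t_def)
  then have e: "0 < e" "e < pi" "cos e = 1 - t"
    unfolding e_def using arccos_lt_bounded[of "1 - t"] by (simp_all add: cos_arccos)
  have c: "cos p < 1" if "p \<in> {e..pi}" for p
    using cos_monotone_0_pi[of 0 p] that e by auto
  have "((\<lambda>p. sin p / (1 - cos p)) has_integral ln (1 - cos pi) - ln (1 - cos e)) {e..pi}"
  proof (intro fundamental_theorem_of_calculus)
    fix p assume "p \<in> {e..pi}"
    then have "((\<lambda>p. ln (1 - cos p)) has_real_derivative sin p / (1 - cos p)) (at p within {e..pi})"
      using c[of p] by (auto intro!: derivative_eq_intros)
    then show "((\<lambda>p. ln (1 - cos p)) has_vector_derivative sin p / (1 - cos p)) (at p within {e..pi})"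
      by (simp add: has_real_derivative_iff_has_vector_derivative)
  qed (use e in auto)
  then have "((\<lambda>p. \<bar>sin p / (1 - cos p)\<bar>) has_integral ln (1 - cos pi) - ln (1 - cos e)) {e..pi}"
    by (rule has_integral_eq[rotated]) (use e c in \<open>auto simp: sin_ge_zero less_imp_le\<close>)
  moreover have "ln (1 - cos pi) - ln (1 - cos e) = ln 2 + (K + 1)"
    by (simp add: e t_def)
  ultimately have h: "((\<lambda>p. \<bar>sin p / (1 - cos p)\<bar>) has_integral ln 2 + (K + 1)) {e..pi}"
    by (simp only:)
  have "integral {e..pi} (\<lambda>p. \<bar>sin p / (1 - cos p)\<bar>) \<le> K"
    unfolding K_def using h i e by (intro integral_subset_le) auto
  then have "ln 2 + (K + 1) \<le> K" using h by (simp add: integral_unique)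
  then show False using ln_gt_zero[of "2::real"] by linarith
qed

lemma borel_measurable_circle_cot_half:
  "(\<lambda>p. complex_of_real (sin p / (1 - cos p))) \<in> borel_measurable circle"
  by (intro borel_measurable_circle_of_borel) measurable

lemma not_integrable_if_AE_eq_cot_half:
  fixes f :: "real \<Rightarrow> complex"
  assumes "AE p in circle. f p = k * of_real (sin p / (1 - cos p))" "integrable circle f"
  shows "k = 0"
proof (rule ccontr)
  assume k: "k \<noteq> 0"
  have "integrable circle (\<lambda>p. k * of_real (sin p / (1 - cos p)))"
    using assms(2) borel_measurable_times[OF borel_measurable_const borel_measurable_circle_cot_half]
      assms(1) by (rule integrable_cong_AE_imp)
  then have "integrable circle (\<lambda>p. inverse k * (k * of_real (sin p / (1 - cos p))))"
    by (rule integrable_mult_right)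
  then have "integrable circle (\<lambda>p. complex_of_real (sin p / (1 - cos p)))"
    using k by (simp add: field_simps)
  with cot_half_not_integrable show False by contradiction
qed

text \<open>The equation gives \<open>f p + b = (a + b) / (1 - cos p)\<close>. Integrability removes
  the singular part, and a constant \<open>f\<close> has zero cosine moment, so \<open>b\<close>,
  then \<open>a\<close>, and then \<open>f\<close> vanish.\<close>

lemma even_threshold_solution_not_integrable:
  assumes "even_threshold_solution lam mu f" shows "\<not> integrable circle f"
proof
  assume int: "integrable circle f"
  define a b where "a = of_real (mu / (2 * pi)) * (LINT q|circle. f q)"
    and "b = of_real (lam / (2 * pi)) * (LINT q|circle. of_real (cos q) * f q)"
  have nz: "ae_nonzero f" and H: "AE p in circle. H_even lam mu f p = 0"
    using assms by (auto simp: even_threshold_solution_def)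
  from H have eq: "AE p in circle. cos p < 1 \<and> of_real (1 - cos p) * f p = a + b * of_real (cos p)"
    using AE_circle_cos_less_1
    by eventually_elim (simp add: H_even_def dispersion_def a_def b_def algebra_simps)
  \<comment> \<open>Multiplication by the bounded sine keeps \<open>f + b\<close> integrable and
    lowers the double pole at 0 to that of cot (p / 2).\<close>
  have "a + b = 0"
  proof (rule not_integrable_if_AE_eq_cot_half)
    show "AE p in circle. of_real (sin p) * (f p + b) = (a + b) * of_real (sin p / (1 - cos p))"
      using eq
    proof eventually_elim
      case (elim p)
      then have "of_real (1 - cos p) * (f p + b) = a + b" by (simp add: algebra_simps)
      moreover have "complex_of_real (1 - cos p) \<noteq> 0" using elim unfolding of_real_eq_0_iff by simp
      ultimately have "f p + b = (a + b) / of_real (1 - cos p)"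
        by (simp add: eq_divide_eq mult.commute)
      then show ?case by simp
    qed
    show "integrable circle (\<lambda>p. of_real (sin p) * (f p + b))"
      using int finite_measure.integrable_const[OF finite_measure_circle]
      by (intro integrable_circle_mult_trig(2) Bochner_Integration.integrable_add)
  qed
  then have b: "b = - a" by (simp add: add_eq_0_iff)
  have f: "AE p in circle. f p = a"
    using eq
  proof eventually_elim
    case (elim p)
    then have "of_real (1 - cos p) * f p = of_real (1 - cos p) * a"
      by (simp add: b algebra_simps)
    moreover have "complex_of_real (1 - cos p) \<noteq> 0" using elim unfolding of_real_eq_0_iff by simp
    ultimately show ?case by (metis mult_cancel_left)
  qed
  then have "AE p in circle. of_real (cos p) * f p = a * of_real (cos p)"
    by eventually_elim simp
  then have "(LINT p|circle. of_real (cos p) * f p) = (LINT p|circle. a * of_real (cos p))"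
    using int by (intro integral_cong_AE borel_measurable_times borel_measurable_circle_trig) auto
  also have "\<dots> = 0"
    using has_bochner_integral_circle_trig(2) by (simp add: has_bochner_integral_iff)
  finally have "a = 0" using b by (simp add: b_def)
  with f nz show False by (simp add: ae_nonzero_def)
qed

lemma odd_threshold_solution_not_integrable:
  assumes "odd_threshold_solution lam f" shows "\<not> integrable circle f"
proof
  assume int: "integrable circle f"
  define c where "c = of_real (lam / (2 * pi)) * (LINT q|circle. of_real (sin q) * f q)"
  have nz: "ae_nonzero f" and H: "AE p in circle. H_odd lam f p = 0"
    using assms by (auto simp: odd_threshold_solution_def)
  from H have f: "AE p in circle. f p = c * of_real (sin p / (1 - cos p))"
    using AE_circle_cos_less_1
  proof eventually_elim
    case (elim p)
    then have "of_real (1 - cos p) * f p = c * of_real (sin p)"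
      by (simp add: H_odd_def dispersion_def c_def algebra_simps)
    moreover have "complex_of_real (1 - cos p) \<noteq> 0" using elim unfolding of_real_eq_0_iff by simp
    ultimately have "f p = c * of_real (sin p) / of_real (1 - cos p)"
      by (simp add: eq_divide_eq mult.commute)
    then show ?case by simp
  qed
  then have "c = 0" using int by (rule not_integrable_if_AE_eq_cot_half)
  with f nz show False by (simp add: ae_nonzero_def)
qed

lemma no_threshold_resonance: "\<not> threshold_resonance lam mu"
  using even_threshold_solution_not_integrable odd_threshold_solution_not_integrable Lspace_1_iff
  unfolding threshold_resonance_def by blast

lemma no_threshold_eigenvalue: "\<not> threshold_eigenvalue lam mu"
  using even_threshold_solution_not_integrable odd_threshold_solution_not_integrable
    Lspace_2_imp_integrable
  unfolding threshold_eigenvalue_def by blast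

section \<open>The super-threshold resonance\<close>

lemma abs_cot_half_le:
  assumes "p \<in> {-pi<..pi}"
  shows "\<bar>sin p / (1 - cos p)\<bar> \<le> 2 * \<bar>p\<bar> powr -1"
\<comment> \<open>At 0 both sides are 0 by the conventions for division by 0 and for
  \<open>0 powr -1\<close>; at \<open>pi\<close> the sine vanishes. Elsewhere the half angle stays
  inside the range where |tan q| \<ge> |q|.\<close>
proof (cases "p = 0 \<or> p = pi")
  case False
  define q where "q = p / 2"
  have p: "p = 2 * q" and q: "q \<noteq> 0" "\<bar>q\<bar> < pi / 2" using False assms by (auto simp: q_def)
  have "1 - cos p = 2 * (sin q)\<^sup>2" by (simp add: p cos_double_sin)
  then have "sin p / (1 - cos p) = cos q / sin q"
    by (simp add: p sin_double power2_eq_square)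
  also have "\<dots> = inverse (tan q)" by (simp add: tan_def)
  also have "\<bar>\<dots>\<bar> \<le> inverse \<bar>q\<bar>"
    using q abs_tan_ge[of q] by (simp add: abs_inverse le_imp_inverse_le)
  finally show ?thesis using q by (simp add: p powr_minus abs_mult)
qed auto

text \<open>The simple pole becomes a multiple of |p|^(-\<epsilon>), integrable at 0 because
  \<epsilon> < 1; the negative half of the circle follows by reflection.\<close>

lemma cot_half_in_Lspace:
  assumes "0 < \<epsilon>" "\<epsilon> < 1"
  shows "(\<lambda>p. complex_of_real (sin p / (1 - cos p))) \<in> Lspace \<epsilon>"
proof -
  have "(\<lambda>p. p powr - \<epsilon>) integrable_on {0..pi}"
    using assms by (intro integrable_on_powr_from_0) auto
  then have "(\<lambda>p. \<bar>p\<bar> powr - \<epsilon>) integrable_on {0..pi}"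
    by (rule integrable_eq) auto
  then have 1: "set_integrable lebesgue {0..pi} (\<lambda>p. \<bar>p\<bar> powr - \<epsilon>)"
    by (intro nonnegative_absolutely_integrable_1) auto
  then have 2: "set_integrable lebesgue {-pi..-0} (\<lambda>p. \<bar>p\<bar> powr - \<epsilon>)"
    by (subst (asm) absolutely_integrable_reflect_real[symmetric]) simp
  have "set_integrable lebesgue ({0..pi} \<union> {-pi..-0}) (\<lambda>p. \<bar>p\<bar> powr - \<epsilon>)"
    by (rule set_integrable_Un[OF 1 2]) auto
  then have "set_integrable lebesgue {-pi<..pi} (\<lambda>p. \<bar>p\<bar> powr - \<epsilon>)"
    by (rule set_integrable_subset) auto
  then have "integrable circle (\<lambda>p. \<bar>p\<bar> powr - \<epsilon>)"
    by (simp add: integrable_restrict_space set_integrable_def)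
  then have i: "integrable circle (\<lambda>p. 2 powr \<epsilon> * \<bar>p\<bar> powr - \<epsilon>)" by simp
  have m: "(\<lambda>p. cmod (of_real (sin p / (1 - cos p))) powr \<epsilon>) \<in> borel_measurable circle"
    by (intro borel_measurable_circle_of_borel) measurable
  have "integrable circle (\<lambda>p. cmod (of_real (sin p / (1 - cos p))) powr \<epsilon>)"
  proof (rule Bochner_Integration.integrable_bound[OF i m], rule AE_I2)
    fix p assume "p \<in> space circle"
    then have "\<bar>sin p / (1 - cos p)\<bar> \<le> 2 * \<bar>p\<bar> powr -1" by (intro abs_cot_half_le) simp
    then have "\<bar>sin p / (1 - cos p)\<bar> powr \<epsilon> \<le> (2 * \<bar>p\<bar> powr -1) powr \<epsilon>"
      using assms by (intro powr_mono2) auto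
    also have "\<dots> = 2 powr \<epsilon> * \<bar>p\<bar> powr - \<epsilon>"
      by (simp only: powr_mult powr_powr mult_minus_left mult_1)
    finally show "norm (cmod (of_real (sin p / (1 - cos p))) powr \<epsilon>) \<le> norm (2 powr \<epsilon> * \<bar>p\<bar> powr - \<epsilon>)"
      unfolding norm_of_real by simp
  qed
  then show ?thesis using borel_measurable_circle_cot_half by (simp add: Lspace_def)
qed

text \<open>The odd equation leaves cot (p / 2) as candidate. Times \<open>sin p\<close> it is
  \<open>1 + cos p\<close>, so its sine moment is \<open>2 * pi\<close>, exactly the value needed
  for coupling 1. The odd sector does not contain \<open>mu\<close>.\<close>

lemma super_threshold_resonance_1: "super_threshold_resonance 1 mu"
proof -
  let ?f = "\<lambda>p. complex_of_real (sin p / (1 - cos p))"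
  have sf: "of_real (sin p) * ?f p = 1 + of_real (cos p)" if "cos p < 1" for p
  proof -
    have "sin p * sin p = (1 - cos p) * (1 + cos p)"
      using sin_cos_squared_add[of p] by (simp add: power2_eq_square algebra_simps)
    then have "sin p * (sin p / (1 - cos p)) = 1 + cos p"
      using that by (simp add: field_simps)
    from arg_cong[OF this, of complex_of_real] show ?thesis by simp
  qed
  have ae: "AE p in circle. of_real (sin p) * ?f p = 1 + of_real (cos p)"
    using AE_circle_cos_less_1 by (rule eventually_mono) (rule sf)
  have "has_bochner_integral circle (\<lambda>p. 1 + complex_of_real (cos p)) (of_real (2 * pi) + 0)"
    by (intro has_bochner_integral_add has_bochner_integral_circle_trig)
  then have I: "has_bochner_integral circle (\<lambda>p. of_real (sin p) * ?f p) (of_real (2 * pi))"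
    using has_bochner_integral_cong_AE[OF _ _ ae] borel_measurable_circle_cot_half
      borel_measurable_circle_trig by (auto intro!: borel_measurable_times)
  have "AE p in circle. H_odd 1 ?f p = 0"
    using AE_circle_cos_less_1
  proof eventually_elim
    case (elim p)
    have "of_real (1 - cos p) * ?f p = of_real (sin p)"
      using elim unfolding of_real_mult[symmetric] by simp
    then show ?case
      using I by (simp add: H_odd_def dispersion_def has_bochner_integral_iff)
  qed
  moreover have "odd_fun ?f" by (simp add: odd_fun_def)
  moreover have "ae_nonzero ?f"
    unfolding ae_nonzero_def
  proof
    assume "AE p in circle. ?f p = 0"
    then have "integrable circle ?f"
      using borel_measurable_circle_cot_half integrable_cong_AE[of ?f circle "\<lambda>_. 0"] by simp
    with cot_half_not_integrable show False by contradiction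
  qed
  ultimately have "odd_threshold_solution 1 ?f"
    using I borel_measurable_circle_cot_half
    by (simp add: odd_threshold_solution_def has_bochner_integral_iff)
  moreover have "?f \<notin> Lspace 1" using cot_half_not_integrable by (simp add: Lspace_1_iff)
  ultimately show ?thesis
    unfolding super_threshold_resonance_def using cot_half_in_Lspace by blast
qed

theorem theorem5p3:
  fixes lam mu :: real
  shows
    "(\<forall>k \<in> {0, 1, 2, 3}. (lam, mu) \<in> D k \<longrightarrow>
        neg_eigenvalue_count lam mu = enat k \<and>
        \<not> threshold_resonance lam mu \<and> \<not> threshold_eigenvalue lam mu)
   \<and> ((lam, mu) \<in> S1 \<longrightarrow> super_threshold_resonance lam mu)
   \<and> ((lam, mu) \<in> B0 \<longrightarrow>
        neg_eigenvalue_count lam mu = 0 \<and>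
        \<not> threshold_resonance lam mu \<and> \<not> threshold_eigenvalue lam mu)
   \<and> ((lam, mu) \<in> B2 \<longrightarrow>
        neg_eigenvalue_count lam mu = 2 \<and>
        \<not> threshold_resonance lam mu \<and> \<not> threshold_eigenvalue lam mu)
   \<and> ((lam, mu) \<in> S1 \<longrightarrow>
        neg_eigenvalue_count lam mu = 1 \<and>
        \<not> threshold_resonance lam mu \<and> \<not> threshold_eigenvalue lam mu)
   \<and> (\<not> threshold_resonance lam mu \<and> \<not> threshold_eigenvalue lam mu)"
proof -
  \<comment> \<open>The summands count the odd root, the even root right of \<open>lam\<close> and
    the even root left of \<open>lam\<close>.\<close>
  have count: "neg_eigenvalue_count lam mu = enat
     ((if 1 < lam then 1 else 0)
    + (if 1 < lam \<or> H0bar lam mu < 0 then 1 else 0)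
    + (if 1 < lam \<and> 0 < H0bar lam mu then 1 else 0))"
    unfolding neg_eigenvalue_count_eq secular_roots(2) H0bar_def by simp
  have "neg_eigenvalue_count lam mu = enat k" if "k \<in> {0, 1, 2, 3}" "(lam, mu) \<in> D k" for k
    using that by (auto simp: count D_def G0_def G1_def G2_def SS_minus_def SS_plus_def lam_s_def)
  moreover have "neg_eigenvalue_count lam mu = 0" if "(lam, mu) \<in> B0"
    using that by (auto simp: count B0_def Gamma_l_def zero_enat_def)
  moreover have "neg_eigenvalue_count lam mu = 2" if "(lam, mu) \<in> B2"
    using that by (auto simp: count B2_def Gamma_r_def numeral_eq_enat)
  \<comment> \<open>At \<open>lam = 1\<close> the value of \<open>H0bar\<close> is -1 for every
    \<open>mu\<close>, so only the even root right of \<open>lam\<close> is present.\<close>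
  moreover have "neg_eigenvalue_count lam mu = 1" if "(lam, mu) \<in> S1"
    using that count by (simp add: S1_def SS_zero_def lam_s_def H0bar_def one_enat_def)
  moreover have "super_threshold_resonance lam mu" if "(lam, mu) \<in> S1"
    using that super_threshold_resonance_1 by (simp add: S1_def SS_zero_def lam_s_def)
  ultimately show ?thesis
    using no_threshold_resonance no_threshold_eigenvalue by blast
qed

end
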